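(* Suppose there are constants $G,R$ such that, uniformly in $t\in\mathbb{Z}_{>0}$ and in the horizon $T$: (i) $|\nabla f_t(x)|\le G$ for all $x\in\Theta$; (ii) $|x_t-x^*|\le R$, where $x_t$ is the decision variable produced by the online random coordinate descent algorithm at time $t$ and $x^*\in\arg\min_{x\in\Theta}\sum_{t=1}^T f_t(x)$. Suppose the stepsize is chosen by the doubling trick scheme: for $q=0,1,\ldots,\lceil\log_2 T\rceil+1$, $\alpha_t=\frac{1}{\sqrt{2^q}}$ in each period of $2^q$ iterations $t=2^q,2^q+1,\ldots,2^{q+1}-1$. Then the static regret of the online random coordinate descent algorithm satisfies $$R_T^s\le (B_1+B_2)\sqrt{T},\qquad B_1=\frac{PR^2}{2},\quad B_2=\frac{\sqrt{2}\,G^2}{2(\sqrt{2}-1)}.$$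
   Context: For each $t\in\mathbb{Z}_{\ge0}$, $f_t:\mathbb{R}^n\to\mathbb{R}$ is convex and continuously differentiable; $\Theta\subseteq\mathbb{R}^n$ is a non-empty closed convex set with Euclidean projection $\Pi_\Theta$; $|\cdot|$ is the Euclidean norm. The decision variable is partitioned into $P$ blocks, $x=(x_{(1)},\ldots,x_{(P)})$, $x_{(p)}\in\mathbb{R}^{n_p}$, $\sum_{p=1}^P n_p=n$, and $\nabla_{(p)}f_t$ denotes the $p$-th block of the gradient. Online random coordinate descent algorithm: start from $x_0\in\Theta$. At each time $t$ select $i_t\in\{1,\ldots,P\}$ uniformly at random (probability $1/P$ each), independently of all previous selections, and set $x_{t+1}=\Pi_\Theta\big(x_t-\alpha_tU_t\nabla f_t(x_t)\big)$, where $\alpha_t>0$ is the stepsize and $U_t$ is the block-diagonal matrix whose $i_t$-th diagonal block is the identity and whose other blocks are zero. (The stepsize rule concerns $t\ge1$; $\alpha_0>0$ is arbitrary.) The static regret is $R_T^s=\sum_{t=1}^T\mathbb{E}[f_t(x_t)]-\min_{x\in\Theta}\sum_{t=1}^T f_t(x)$. *)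

theory Defs
  imports "HOL-Probability.Probability"
begin

text \<open>
  The partition of the coordinates into blocks is given by a map \<open>blk\<close>
  sending a coordinate to the number of its block: block \<open>p\<close> of \<open>x\<close> consists of the
  components \<open>x $ k\<close> with \<open>blk k = p\<close>, and \<open>n\<^sub>p\<close> is the cardinality of \<open>{k. blk k = p}\<close>.
\<close>

definition block_selector :: "('n::finite \<Rightarrow> nat) \<Rightarrow> nat \<Rightarrow> real ^ 'n ^ 'n" where
  "block_selector blk p = (\<chi> k l. if k = l \<and> blk k = p then 1 else 0)"

text \<open>
  The iterates for a given realization \<open>sel\<close> of the block selections;
  \<open>gradf t\<close> is the gradient map of the \<open>t\<close>-th cost function.
  \<^const>\<open>closest_point\<close> is the Euclidean projection.
\<close>

primrec rcd_iterate ::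
  "(real ^ 'n::finite) set \<Rightarrow> ('n \<Rightarrow> nat) \<Rightarrow> (nat \<Rightarrow> real) \<Rightarrow> (nat \<Rightarrow> real ^ 'n \<Rightarrow> real ^ 'n)
    \<Rightarrow> real ^ 'n \<Rightarrow> (nat \<Rightarrow> nat) \<Rightarrow> nat \<Rightarrow> real ^ 'n" where
  "rcd_iterate \<Theta> blk \<alpha> gradf x0 sel 0 = x0"
| "rcd_iterate \<Theta> blk \<alpha> gradf x0 sel (Suc t) =
     closest_point \<Theta>
       (rcd_iterate \<Theta> blk \<alpha> gradf x0 sel t
        - \<alpha> t *\<^sub>R (block_selector blk (sel t) *v gradf t (rcd_iterate \<Theta> blk \<alpha> gradf x0 sel t)))"

definition uniform_block_selections :: "'w measure \<Rightarrow> nat \<Rightarrow> (nat \<Rightarrow> 'w \<Rightarrow> nat) \<Rightarrow> bool" where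
  "uniform_block_selections M P i \<longleftrightarrow>
     prob_space.indep_vars M (\<lambda>_. count_space {1..P}) i UNIV \<and>
     (\<forall>t. distr M (count_space {1..P}) (i t) = uniform_count_measure {1..P})"

definition doubling_trick :: "(nat \<Rightarrow> real) \<Rightarrow> nat \<Rightarrow> bool" where
  "doubling_trick \<alpha> T \<longleftrightarrow>
     (\<forall>q::nat. int q \<le> \<lceil>log 2 (real T)\<rceil> + 1 \<longrightarrow>
        (\<forall>t \<in> {2 ^ q .. 2 ^ (q + 1) - 1}. \<alpha> t = 1 / sqrt (2 ^ q)))"

text \<open>
  \<open>LEAST\<close> is the minimum of the set of attained values; it is meaningful
  whenever a minimizer over \<open>\<Theta>\<close> exists.
\<close>

definition static_regret ::
  "'w measure \<Rightarrow> 'v set \<Rightarrow> (nat \<Rightarrow> 'v \<Rightarrow> real) \<Rightarrow> (nat \<Rightarrow> 'w \<Rightarrow> 'v) \<Rightarrow> nat \<Rightarrow> real" where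
  "static_regret M \<Theta> f x T =
     (\<Sum>t=1..T. prob_space.expectation M (\<lambda>\<omega>. f t (x t \<omega>)))
     - (LEAST v. v \<in> (\<lambda>y. \<Sum>t=1..T. f t y) ` \<Theta>)"

end

theory Submission
  imports Defs
begin

text \<open>
  Fix a horizon \<open>T\<close> with minimizer \<open>z\<close>. Projection onto \<open>\<Theta>\<close> does not increase the distance to
  \<open>z \<in> \<Theta>\<close>, so one step with block \<open>p\<close> satisfies
  \<open>|x\<^sub>t\<^sub>+\<^sub>1 - z|\<^sup>2 \<le> |x\<^sub>t - z|\<^sup>2 - 2 \<alpha>\<^sub>t \<langle>U\<^sub>p g, x\<^sub>t - z\<rangle> + \<alpha>\<^sub>t\<^sup>2 |U\<^sub>p g|\<^sup>2\<close> with \<open>g = \<nabla>f\<^sub>t(x\<^sub>t)\<close>.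
  The selection \<open>i\<^sub>t\<close> is uniform and independent of \<open>x\<^sub>t\<close>, which depends only on
  \<open>i\<^sub>0, \<dots>, i\<^sub>t\<^sub>-\<^sub>1\<close>; hence its effect on an expectation is to average over \<open>p\<close>
  (\<open>expectation_uniform_selection\<close>). As the matrices \<open>U\<^sub>p\<close> sum to the identity, averaging turns
  the last two terms into \<open>1/P\<close> times those of a full gradient step, and convexity yields
  \<open>E[f\<^sub>t(x\<^sub>t) - f\<^sub>t(z)] \<le> P/(2 \<alpha>\<^sub>t) (V\<^sub>t - V\<^sub>t\<^sub>+\<^sub>1) + G\<^sup>2 \<alpha>\<^sub>t / 2\<close> for \<open>V\<^sub>t = E|x\<^sub>t - z|\<^sup>2\<close>
  (\<open>rcd_expected_progress\<close>).

  The stepsizes do not increase across the periods either, so the sum over \<open>t\<close> need not be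
  restarted in each period: summation by parts (\<open>weighted_telescope\<close>) bounds the first terms
  by \<open>P R\<^sup>2 / (2 \<alpha>\<^sub>T)\<close>. The doubling trick is, up to a factor \<open>\<surd>2\<close>, the schedule
  \<open>1 / \<surd>t\<close>: it satisfies \<open>1 / \<surd>t \<le> \<alpha>\<^sub>t \<le> \<surd>2 / \<surd>t\<close>. The first bound gives the constant \<open>B\<^sub>1\<close>;
  the second gives \<open>\<Sum>t\<le>T. \<alpha>\<^sub>t \<le> 2 \<surd>2 \<surd>T\<close>, and \<open>2 \<surd>2 \<le> \<surd>2 / (\<surd>2 - 1)\<close> gives \<open>B\<^sub>2\<close>.
\<close>

section \<open>Block selection and the projected step\<close>

lemma block_selector_mult_vec:
  "block_selector blk p *v v = (\<chi> k. if blk k = p then v $ k else 0)"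
proof -
  have "(\<Sum>l\<in>UNIV. (if k = l \<and> blk k = p then 1 else 0) * v $ l)
      = (\<Sum>l\<in>UNIV. if k = l then (if blk k = p then v $ k else 0) else 0)" for k
    by (intro sum.cong) auto
  then show ?thesis
    by (simp add: block_selector_def matrix_vector_mult_def vec_eq_iff)
qed

lemma sum_inner_block_selector:
  fixes v w :: "real ^ 'n::finite"
  assumes "range blk \<subseteq> {1..P}"
  shows "(\<Sum>p=1..P. (block_selector blk p *v v) \<bullet> w) = v \<bullet> w"
proof -
  have "(\<Sum>p=1..P. (block_selector blk p *v v) \<bullet> w)
      = (\<Sum>k\<in>UNIV. \<Sum>p=1..P. if blk k = p then v $ k * w $ k else 0)"
    by (subst sum.swap, auto simp: block_selector_mult_vec inner_vec_def intro!: sum.cong)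
  also have "\<dots> = v \<bullet> w"
    using assms by (auto simp: inner_vec_def image_subset_iff intro!: sum.cong)
  finally show ?thesis .
qed

lemma norm_block_selector_sq:
  fixes v :: "real ^ 'n::finite"
  shows "(norm (block_selector blk p *v v))\<^sup>2 = (block_selector blk p *v v) \<bullet> v"
  by (auto simp: power2_norm_eq_inner block_selector_mult_vec inner_vec_def intro!: sum.cong)

text \<open>
  Expanding the squares, every term that contains \<open>U\<^sub>p\<close> is linear in it, because
  \<open>|U\<^sub>p g|\<^sup>2 = \<langle>U\<^sub>p g, g\<rangle>\<close>; the sum over \<open>p\<close> then replaces \<open>U\<^sub>p\<close> by the identity.
\<close>

lemma average_norm_sq_block_step:
  fixes y g z :: "real ^ 'n::finite"
  assumes "range blk \<subseteq> {1..P}"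
  shows "(\<Sum>p=1..P. (norm (y - a *\<^sub>R (block_selector blk p *v g) - z))\<^sup>2) / real P
       = (norm (y - z))\<^sup>2 - 2 * a / real P * (g \<bullet> (y - z)) + a\<^sup>2 / real P * (norm g)\<^sup>2"
proof -
  have "P > 0" using assms by (auto simp: image_subset_iff Suc_le_eq intro: le_less_trans)
  have sq: "(norm (y - a *\<^sub>R (block_selector blk p *v g) - z))\<^sup>2
     = (norm (y - z))\<^sup>2 - 2 * a * ((block_selector blk p *v g) \<bullet> (y - z))
       + a\<^sup>2 * ((block_selector blk p *v g) \<bullet> g)" for p
  proof -
    have "y - a *\<^sub>R (block_selector blk p *v g) - z = (y - z) - a *\<^sub>R (block_selector blk p *v g)"
      by simp
    then show ?thesis
      unfolding norm_block_selector_sq[symmetric]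
      by (simp only: power2_norm_eq_inner)
        (simp add: inner_diff_left inner_diff_right inner_commute power2_eq_square algebra_simps)
  qed
  show ?thesis
    unfolding sq sum.distrib sum_subtractf sum_distrib_left[symmetric]
      sum_inner_block_selector[OF assms]
    using \<open>P > 0\<close> by (simp add: field_simps power2_norm_eq_inner)
qed

lemma closest_point_norm_le:
  assumes "convex S" "closed S" "z \<in> S"
  shows "norm (closest_point S y - z) \<le> norm (y - z)"
  using closest_point_lipschitz[of S y z] assms closest_point_self[of z S]
  by (auto simp: dist_norm)

lemma rcd_iterate_in_set:
  assumes "closed \<Theta>" "x0 \<in> \<Theta>"
  shows "rcd_iterate \<Theta> blk \<alpha> gradf x0 sel t \<in> \<Theta>"
  using assms by (cases t) (auto intro: closest_point_in_set)

lemma rcd_iterate_cong: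
  assumes "\<And>s. s < t \<Longrightarrow> sel s = sel' s"
  shows "rcd_iterate \<Theta> blk \<alpha> gradf x0 sel t = rcd_iterate \<Theta> blk \<alpha> gradf x0 sel' t"
  using assms by (induction t) auto

text \<open>
  The one-dimensional tangent inequality along the segment from \<open>y\<close> to \<open>z\<close>.
\<close>

lemma convex_on_gradient_inequality:
  fixes f :: "'a::real_inner \<Rightarrow> real"
  assumes "convex_on UNIV f" "GDERIV f y :> g"
  shows "f y - f z \<le> g \<bullet> (y - z)"
proof -
  let ?h = "\<lambda>s::real. f (y + s *\<^sub>R (z - y))"
  have "convex_on UNIV ?h"
  proof (rule convex_onI)
    fix u a b :: real
    assume u: "0 < u" "u < 1"
    have "y + ((1 - u) *\<^sub>R a + u *\<^sub>R b) *\<^sub>R (z - y)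
        = (1 - u) *\<^sub>R (y + a *\<^sub>R (z - y)) + u *\<^sub>R (y + b *\<^sub>R (z - y))"
      by (simp add: algebra_simps)
    then show "?h ((1 - u) *\<^sub>R a + u *\<^sub>R b) \<le> (1 - u) * ?h a + u * ?h b"
      using convex_onD[OF assms(1), of u] u by simp
  qed simp
  moreover have "(?h has_field_derivative g \<bullet> (z - y)) (at 0)"
  proof -
    have f: "(f has_derivative (\<lambda>h. h \<bullet> g)) (at (y + 0 *\<^sub>R (z - y)))"
      using assms(2) by (simp add: gderiv_def)
    have "((\<lambda>s::real. y + s *\<^sub>R (z - y)) has_derivative (\<lambda>s. s *\<^sub>R (z - y))) (at 0)"
      by (auto intro!: derivative_eq_intros)
    from has_derivative_compose[OF this f] show ?thesis
      by (simp add: has_field_derivative_def inner_commute mult.commute[of "inner _ _"] mult_commute_abs)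
  qed
  ultimately have "?h 1 - ?h 0 \<ge> (g \<bullet> (z - y)) * (1 - 0)"
    by (intro convex_on_imp_above_tangent[where A = UNIV]) auto
  then show ?thesis
    by (simp add: inner_diff_right)
qed

section \<open>Averaging over an independent uniform selection\<close>

lemma (in prob_space) integrable_finite_valued:
  fixes h :: "'b \<Rightarrow> real"
  assumes Y: "Y \<in> measurable M (count_space S)" and "finite S"
  shows "integrable M (\<lambda>\<omega>. h (Y \<omega>))"
proof (rule integrable_const_bound[where B = "\<Sum>s\<in>S. \<bar>h s\<bar>"])
  show "AE \<omega> in M. norm (h (Y \<omega>)) \<le> (\<Sum>s\<in>S. \<bar>h s\<bar>)"
    using measurable_space[OF Y] \<open>finite S\<close> by (auto intro!: AE_I2 member_le_sum)
  show "(\<lambda>\<omega>. h (Y \<omega>)) \<in> borel_measurable M"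
    by (rule measurable_compose[OF Y]) simp
qed

text \<open>
  A conditional expectation given \<open>Y\<close>, in elementary form: split according to the value of \<open>J\<close>
  and factor each piece by independence. As \<^const>\<open>prob_space.indep_var\<close> relates variables
  of one type, independence of \<open>Y\<close> and \<open>J\<close> is expressed through real functions of them.
\<close>

lemma (in prob_space) expectation_uniform_selection:
  fixes h :: "'b \<Rightarrow> nat \<Rightarrow> real"
  assumes Y: "Y \<in> measurable M (count_space S)" and "finite S"
    and J: "J \<in> measurable M (count_space {1..P})"
    and ind: "\<And>(g :: 'b \<Rightarrow> real) (k :: nat \<Rightarrow> real).
                indep_var borel (\<lambda>\<omega>. g (Y \<omega>)) borel (\<lambda>\<omega>. k (J \<omega>))"
    and unif: "distr M (count_space {1..P}) J = uniform_count_measure {1..P}"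
  shows "expectation (\<lambda>\<omega>. h (Y \<omega>) (J \<omega>)) = expectation (\<lambda>\<omega>. (\<Sum>p=1..P. h (Y \<omega>) p) / real P)"
proof -
  note int_Y = integrable_finite_valued[OF Y \<open>finite S\<close>]
  have int_J: "integrable M (\<lambda>\<omega>. k (J \<omega>))" for k :: "nat \<Rightarrow> real"
    by (rule integrable_finite_valued[OF J]) simp
  have ind_p: "indep_var borel (\<lambda>\<omega>. h (Y \<omega>) p) borel (\<lambda>\<omega>. indicator {p} (J \<omega>) :: real)" for p
    by (rule ind)
  have prob_p: "expectation (\<lambda>\<omega>. indicator {p} (J \<omega>)) = 1 / real P" if "p \<in> {1..P}" for p
  proof -
    have "expectation (\<lambda>\<omega>. indicator {p} (J \<omega>) :: real)
        = integral\<^sup>L (distr M (count_space {1..P}) J) (indicator {p})"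
      by (rule integral_distr[OF J, symmetric]) simp
    also have "\<dots> = 1 / real P"
      unfolding unif using that by (simp add: measure_uniform_count_measure space_uniform_count_measure)
    finally show ?thesis .
  qed
  have "expectation (\<lambda>\<omega>. h (Y \<omega>) (J \<omega>))
      = expectation (\<lambda>\<omega>. \<Sum>p=1..P. h (Y \<omega>) p * indicator {p} (J \<omega>))"
  proof (rule Bochner_Integration.integral_cong[OF refl])
    fix \<omega> assume "\<omega> \<in> space M"
    then have "J \<omega> \<in> {1..P}" using measurable_space[OF J] by auto
    then show "h (Y \<omega>) (J \<omega>) = (\<Sum>p=1..P. h (Y \<omega>) p * indicator {p} (J \<omega>))"
      by (subst sum.remove[where x = "J \<omega>"]) (auto simp: indicator_def intro!: sum.neutral)
  qed
  also have "\<dots> = (\<Sum>p=1..P. expectation (\<lambda>\<omega>. h (Y \<omega>) p * indicator {p} (J \<omega>)))"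
    by (intro Bochner_Integration.integral_sum indep_var_integrable[OF ind_p] int_Y int_J)
  also have "\<dots> = (\<Sum>p=1..P. expectation (\<lambda>\<omega>. h (Y \<omega>) p) * (1 / real P))"
    by (intro sum.cong refl)
      (simp only: indep_var_lebesgue_integral[OF ind_p int_Y int_J] prob_p)
  also have "\<dots> = expectation (\<lambda>\<omega>. (\<Sum>p=1..P. h (Y \<omega>) p) / real P)"
    by (simp add: Bochner_Integration.integral_sum[where f = "\<lambda>p \<omega>. h (Y \<omega>) p", OF int_Y]
        sum_divide_distrib[symmetric])
  finally show ?thesis .
qed

text \<open>
  The prefix \<open>i\<^sub>0, \<dots>, i\<^sub>t\<^sub>-\<^sub>1\<close> determines \<open>x\<^sub>t\<close> and takes finitely many values, so every
  real function of \<open>x\<^sub>t\<close> is a simple function: measurable, bounded and integrable.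
\<close>

definition selection_prefix :: "(nat \<Rightarrow> 'w \<Rightarrow> nat) \<Rightarrow> nat \<Rightarrow> 'w \<Rightarrow> nat \<Rightarrow> nat" where
  "selection_prefix i t \<omega> = restrict (\<lambda>s. i s \<omega>) {..<t}"

abbreviation prefixes :: "nat \<Rightarrow> nat \<Rightarrow> (nat \<Rightarrow> nat) set" where
  "prefixes P t \<equiv> PiE {..<t} (\<lambda>_. {1..P})"

lemma rcd_iterate_selection_prefix:
  "rcd_iterate \<Theta> blk \<alpha> gradf x0 (\<lambda>s. i s \<omega>) t
     = rcd_iterate \<Theta> blk \<alpha> gradf x0 (selection_prefix i t \<omega>) t"
  by (rule rcd_iterate_cong) (simp add: selection_prefix_def)

lemma finite_prefixes: "finite (prefixes P t)"
  by (intro finite_PiE) auto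

lemma (in prob_space) measurable_selection_prefix:
  assumes "uniform_block_selections M P i"
  shows "selection_prefix i t \<in> measurable M (count_space (prefixes P t))"
proof -
  have "i s \<in> measurable M (count_space {1..P})" for s
    using assms by (auto simp: uniform_block_selections_def indep_vars_def)
  then have "selection_prefix i t \<in> measurable M (PiM {..<t} (\<lambda>_. count_space {1..P}))"
    unfolding selection_prefix_def[abs_def] by (intro measurable_restrict)
  then show ?thesis
    by (simp add: count_space_PiM_finite)
qed

lemma (in prob_space) indep_selection_prefix:
  fixes g :: "(nat \<Rightarrow> nat) \<Rightarrow> real" and k :: "nat \<Rightarrow> real"
  assumes "uniform_block_selections M P i"
  shows "indep_var borel (\<lambda>\<omega>. g (selection_prefix i t \<omega>)) borel (\<lambda>\<omega>. k (i t \<omega>))"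
proof -
  have "indep_vars (\<lambda>_. count_space {1..P}) i UNIV"
    using assms by (simp add: uniform_block_selections_def)
  from indep_var_restrict[OF this, of "{..<t}" "{t}"]
  have "indep_var (count_space (prefixes P t)) (selection_prefix i t)
          (count_space (PiE {t} (\<lambda>_. {1..P}))) (\<lambda>\<omega>. restrict (\<lambda>s. i s \<omega>) {t})"
    by (simp add: count_space_PiM_finite selection_prefix_def[abs_def])
  from indep_var_compose[OF this, of g borel "\<lambda>s. k (s t)" borel]
  show ?thesis
    by (simp add: o_def)
qed

section \<open>Expected progress of one iteration\<close>

context prob_space
begin

lemma integrable_rcd_iterate:
  fixes h :: "real ^ 'n::finite \<Rightarrow> real"
  assumes "uniform_block_selections M P i"
  shows "integrable M (\<lambda>\<omega>. h (rcd_iterate \<Theta> blk \<alpha> gradf x0 (\<lambda>s. i s \<omega>) t))"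
  unfolding rcd_iterate_selection_prefix
  by (rule integrable_finite_valued[OF measurable_selection_prefix[OF assms] finite_prefixes])

text \<open>
  The factor \<open>2 \<alpha>\<^sub>t / P\<close> is the price of coordinate descent: averaging over
  the blocks leaves \<open>1/P\<close> of the descent term of a full gradient step, and dividing by this
  factor multiplies the decrease of the squared distance by \<open>P\<close>. The quadratic term carries the
  same \<open>1/P\<close>, so \<open>P\<close> cancels there.
\<close>

lemma rcd_expected_progress:
  fixes \<Theta> :: "(real ^ 'n::finite) set" and z :: "real ^ 'n" and i blk \<alpha> gradf x0
  defines "x \<equiv> \<lambda>t \<omega>. rcd_iterate \<Theta> blk \<alpha> gradf x0 (\<lambda>s. i s \<omega>) t"
  assumes "closed \<Theta>" "convex \<Theta>" "x0 \<in> \<Theta>" "z \<in> \<Theta>"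
    and blk: "range blk \<subseteq> {1..P}"
    and sel: "uniform_block_selections M P i"
    and "\<alpha> t > 0"
    and f: "convex_on UNIV f" "\<And>y. GDERIV f y :> gradf t y"
    and grad: "\<And>y. y \<in> \<Theta> \<Longrightarrow> norm (gradf t y) \<le> G"
  shows "expectation (\<lambda>\<omega>. f (x t \<omega>)) - f z
      \<le> real P / (2 * \<alpha> t) * (expectation (\<lambda>\<omega>. (norm (x t \<omega> - z))\<^sup>2)
                              - expectation (\<lambda>\<omega>. (norm (x (Suc t) \<omega> - z))\<^sup>2))
        + G\<^sup>2 / 2 * \<alpha> t"
proof -
  let ?it = "\<lambda>y. rcd_iterate \<Theta> blk \<alpha> gradf x0 y t"
  let ?Y = "selection_prefix i t"
  let ?step = "\<lambda>y p. (norm (?it y - \<alpha> t *\<^sub>R (block_selector blk p *v gradf t (?it y)) - z))\<^sup>2"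
  have P: "P > 0" using blk by (auto simp: image_subset_iff Suc_le_eq intro: le_less_trans)
  have int_x: "integrable M (\<lambda>\<omega>. h (x t \<omega>))" for h :: "real ^ 'n \<Rightarrow> real" and t
    unfolding x_def by (rule integrable_rcd_iterate[OF sel])
  have x_Y: "x t \<omega> = ?it (?Y \<omega>)" for \<omega>
    unfolding x_def by (rule rcd_iterate_selection_prefix)
  have int_step: "integrable M (\<lambda>\<omega>. ?step (?Y \<omega>) (i t \<omega>))"
  proof -
    \<comment> \<open>The prefix of length \<open>Suc t\<close> determines both arguments.\<close>
    have "?step (?Y \<omega>) (i t \<omega>) = ?step (selection_prefix i (Suc t) \<omega>) (selection_prefix i (Suc t) \<omega> t)" for \<omega>
    proof -
      have "?it (?Y \<omega>) = ?it (selection_prefix i (Suc t) \<omega>)"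
        by (rule rcd_iterate_cong) (simp add: selection_prefix_def)
      then show ?thesis by (simp add: selection_prefix_def)
    qed
    then show ?thesis
      using integrable_finite_valued[OF measurable_selection_prefix[OF sel, of "Suc t"]
          finite_prefixes, of "\<lambda>y. ?step y (y t)"] by simp
  qed
  have "expectation (\<lambda>\<omega>. (norm (x (Suc t) \<omega> - z))\<^sup>2) \<le> expectation (\<lambda>\<omega>. ?step (?Y \<omega>) (i t \<omega>))"
  proof (rule integral_mono[OF int_x[of "\<lambda>y. (norm (y - z))\<^sup>2"] int_step])
    fix \<omega>
    have "norm (x (Suc t) \<omega> - z)
        \<le> norm (x t \<omega> - \<alpha> t *\<^sub>R (block_selector blk (i t \<omega>) *v gradf t (x t \<omega>)) - z)"
      unfolding x_def rcd_iterate.simps by (rule closest_point_norm_le) fact+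
    then show "(norm (x (Suc t) \<omega> - z))\<^sup>2 \<le> ?step (?Y \<omega>) (i t \<omega>)"
      by (simp add: x_Y power_mono)
  qed
  also have "\<dots> = expectation (\<lambda>\<omega>. (\<Sum>p=1..P. ?step (?Y \<omega>) p) / real P)"
    using sel by (intro expectation_uniform_selection[OF measurable_selection_prefix[OF sel]
        finite_prefixes _ indep_selection_prefix[OF sel]])
      (auto simp: uniform_block_selections_def indep_vars_def)
  also have "\<dots> = expectation (\<lambda>\<omega>. (norm (x t \<omega> - z))\<^sup>2
      - 2 * \<alpha> t / real P * (gradf t (x t \<omega>) \<bullet> (x t \<omega> - z)) + (\<alpha> t)\<^sup>2 / real P * (norm (gradf t (x t \<omega>)))\<^sup>2)"
    unfolding average_norm_sq_block_step[OF blk] x_Y ..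
  also have "\<dots> \<le> expectation (\<lambda>\<omega>. (norm (x t \<omega> - z))\<^sup>2
      - 2 * \<alpha> t / real P * (f (x t \<omega>) - f z) + (\<alpha> t)\<^sup>2 / real P * G\<^sup>2)"
  proof (rule integral_mono)
    fix \<omega>
    have "x t \<omega> \<in> \<Theta>" unfolding x_def by (rule rcd_iterate_in_set) fact+
    then have "(norm (gradf t (x t \<omega>)))\<^sup>2 \<le> G\<^sup>2" using grad by (simp add: power_mono)
    moreover have "f (x t \<omega>) - f z \<le> gradf t (x t \<omega>) \<bullet> (x t \<omega> - z)"
      by (rule convex_on_gradient_inequality[OF f])
    ultimately show "(norm (x t \<omega> - z))\<^sup>2
        - 2 * \<alpha> t / real P * (gradf t (x t \<omega>) \<bullet> (x t \<omega> - z)) + (\<alpha> t)\<^sup>2 / real P * (norm (gradf t (x t \<omega>)))\<^sup>2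
      \<le> (norm (x t \<omega> - z))\<^sup>2 - 2 * \<alpha> t / real P * (f (x t \<omega>) - f z) + (\<alpha> t)\<^sup>2 / real P * G\<^sup>2"
      using \<open>\<alpha> t > 0\<close> by (intro add_mono diff_mono mult_left_mono) auto
  qed (rule int_x)+
  also have "\<dots> = expectation (\<lambda>\<omega>. (norm (x t \<omega> - z))\<^sup>2)
      - 2 * \<alpha> t / real P * (expectation (\<lambda>\<omega>. f (x t \<omega>)) - f z) + (\<alpha> t)\<^sup>2 / real P * G\<^sup>2"
    using int_x[of "\<lambda>y. (norm (y - z))\<^sup>2" t] int_x[of f t]
    by (simp add: prob_space del: of_nat_eq_0_iff)
  finally show ?thesis
    using \<open>\<alpha> t > 0\<close> P by (simp add: field_simps power2_eq_square)
qed

end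

section \<open>Summation over the horizon\<close>

text \<open>
  Summation by parts as an induction: since \<open>v (Suc T) \<le> B\<close>, the weight in the retained
  remainder \<open>w T * (B - v (Suc T))\<close> can be raised to \<open>w (Suc T)\<close>, and then the next summand is
  absorbed exactly.
\<close>

lemma weighted_telescope:
  fixes w v :: "nat \<Rightarrow> real"
  assumes mono: "\<And>t. t > 0 \<Longrightarrow> w t \<le> w (Suc t)" and nonneg: "\<And>t. t > 0 \<Longrightarrow> w t \<ge> 0"
    and bnd: "\<And>t. t > 0 \<Longrightarrow> v t \<le> B" and "T > 0"
  shows "(\<Sum>t=1..T. w t * (v t - v (Suc t))) \<le> w T * (B - v (Suc T))"
  using \<open>T > 0\<close>
proof (induction T rule: nat_induct_non_zero)
  case 1
  then show ?case using nonneg[of 1] bnd[of 1] by (simp add: mult_left_mono)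
next
  case (Suc T)
  have "w T * (B - v (Suc T)) \<le> w (Suc T) * (B - v (Suc T))"
    using mono[OF Suc.hyps] bnd[of "Suc T"] by (intro mult_right_mono) auto
  with Suc.IH show ?case by (simp add: algebra_simps)
qed

lemma sum_inverse_sqrt_le: "(\<Sum>t=1..T. 1 / sqrt (real t)) \<le> 2 * sqrt (real T)"
proof (induction T)
  case (Suc T)
  define a b where "a = sqrt (real T)" and "b = sqrt (real (Suc T))"
  have "0 \<le> (b - a)\<^sup>2" "a\<^sup>2 = real T" "b\<^sup>2 = real T + 1" "b > 0"
    by (auto simp: a_def b_def)
  then have "1 / b \<le> 2 * b - 2 * a"
    by (simp add: field_simps power2_eq_square)
  with Suc show ?case by (simp add: a_def b_def)
qed simp

text \<open>
  With \<open>t\<close> itself as the horizon, its period \<open>q\<close> is among those covered, as \<open>q \<le> log\<^sub>2 t\<close>.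
\<close>

lemma doubling_trick_stepsize:
  assumes "doubling_trick \<alpha> t" "t > 0"
  obtains q where "2 ^ q \<le> t" "t < 2 ^ Suc q" "\<alpha> t = 1 / sqrt (2 ^ q)"
proof -
  obtain q where q: "2 ^ q \<le> t" "t < 2 ^ (q + 1)"
    using ex_power_ivl1[of 2 t] \<open>t > 0\<close> by auto
  have "real (2 ^ q) \<le> real t" using q(1) by (simp only: of_nat_le_iff)
  then have "real q \<le> log 2 (real t)"
    using \<open>t > 0\<close> by (simp add: le_log_iff powr_realpow)
  then have "int q \<le> \<lceil>log 2 (real t)\<rceil> + 1" by linarith
  moreover have "t \<in> {2 ^ q .. 2 ^ (q + 1) - 1}" using q by auto
  ultimately have "\<alpha> t = 1 / sqrt (2 ^ q)"
    using assms(1) unfolding doubling_trick_def by blast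
  with q that show thesis by simp
qed

lemma doubling_trick_bounds:
  assumes "doubling_trick \<alpha> t" "t > 0"
  shows "1 / \<alpha> t \<le> sqrt (real t)" "\<alpha> t \<le> sqrt 2 / sqrt (real t)"
proof -
  obtain q where q: "2 ^ q \<le> t" "t < 2 ^ Suc q" "\<alpha> t = 1 / sqrt (2 ^ q)"
    using doubling_trick_stepsize[OF assms] .
  have "real (2 ^ q) \<le> real t" using q(1) by (simp only: of_nat_le_iff)
  then show "1 / \<alpha> t \<le> sqrt (real t)" using q(3) by simp
  have "real t \<le> real (2 ^ Suc q)" using q(2) by (simp only: of_nat_le_iff)
  then have "sqrt (real t) \<le> sqrt 2 * sqrt (2 ^ q)"
    by (simp flip: real_sqrt_mult)
  then show "\<alpha> t \<le> sqrt 2 / sqrt (real t)" using \<open>t > 0\<close> unfolding q(3) by (simp add: divide_simps)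
qed

lemma doubling_trick_decreasing:
  assumes "doubling_trick \<alpha> t" "doubling_trick \<alpha> (Suc t)" "t > 0"
  shows "1 / \<alpha> t \<le> 1 / \<alpha> (Suc t)"
proof -
  obtain q where q: "2 ^ q \<le> t" "\<alpha> t = 1 / sqrt (2 ^ q)"
    using doubling_trick_stepsize[OF assms(1,3)] .
  obtain r where r: "Suc t < 2 ^ Suc r" "\<alpha> (Suc t) = 1 / sqrt (2 ^ r)"
    using doubling_trick_stepsize[OF assms(2)] by blast
  have "(2::nat) ^ q < 2 ^ Suc r" using q(1) r(1) by linarith
  then have "q \<le> r" by (simp only: power_strict_increasing_iff less_Suc_eq_le)
  then show ?thesis using q(2) r(2) by simp
qed

lemma static_regret_eq:
  assumes "is_arg_min (\<lambda>y. \<Sum>t=1..T. f t y) (\<lambda>y. y \<in> \<Theta>) z"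
  shows "static_regret M \<Theta> f x T = (\<Sum>t=1..T. prob_space.expectation M (\<lambda>\<omega>. f t (x t \<omega>)) - f t z)"
proof -
  have "(LEAST v. v \<in> (\<lambda>y. \<Sum>t=1..T. f t y) ` \<Theta>) = (\<Sum>t=1..T. f t z)"
    using assms by (intro Least_equality) (auto simp: is_arg_min_linorder)
  then show ?thesis by (simp add: static_regret_def sum_subtractf)
qed

theorem theorem1:
  fixes M :: "'w measure"
    and \<Theta> :: "(real ^ 'n::finite) set"
    and f :: "nat \<Rightarrow> real ^ 'n \<Rightarrow> real"
    and gradf :: "nat \<Rightarrow> real ^ 'n \<Rightarrow> real ^ 'n"
    and P :: nat
    and blk :: "'n \<Rightarrow> nat"
    and i :: "nat \<Rightarrow> 'w \<Rightarrow> nat"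
    and \<alpha> :: "nat \<Rightarrow> real"
    and x0 :: "real ^ 'n"
    and x :: "nat \<Rightarrow> 'w \<Rightarrow> real ^ 'n"
    and xstar :: "nat \<Rightarrow> real ^ 'n"
    and G R :: real
  assumes "\<Theta> \<noteq> {}" and "closed \<Theta>" and "convex \<Theta>"
    and "\<And>t. convex_on UNIV (f t)"
    and "\<And>t y. GDERIV (f t) y :> gradf t y"
    and "\<And>t. continuous_on UNIV (gradf t)"
    and "range blk \<subseteq> {1..P}"
    and "prob_space M"
    and "uniform_block_selections M P i"
    and "x0 \<in> \<Theta>"
    and "\<And>t. \<alpha> t > 0"
    and x_def: "\<And>t \<omega>. x t \<omega> = rcd_iterate \<Theta> blk \<alpha> gradf x0 (\<lambda>s. i s \<omega>) t"
    and xstar: "\<And>T. T > 0 \<Longrightarrow> is_arg_min (\<lambda>y. \<Sum>t=1..T. f t y) (\<lambda>y. y \<in> \<Theta>) (xstar T)"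
    and grad_bound: "\<And>t y. t > 0 \<Longrightarrow> y \<in> \<Theta> \<Longrightarrow> norm (gradf t y) \<le> G"
    and iterate_bound: "\<And>t T. t > 0 \<Longrightarrow> T > 0 \<Longrightarrow> (AE \<omega> in M. norm (x t \<omega> - xstar T) \<le> R)"
    and stepsize: "\<And>T. T > 0 \<Longrightarrow> doubling_trick \<alpha> T"
  shows "\<forall>T>0. static_regret M \<Theta> f x T
           \<le> (real P * R\<^sup>2 / 2 + sqrt 2 * G\<^sup>2 / (2 * (sqrt 2 - 1))) * sqrt (real T)"
proof (intro allI impI)
  fix T :: nat assume T: "T > 0"
  interpret prob_space M by fact
  let ?z = "xstar T"
  define V where "V t = expectation (\<lambda>\<omega>. (norm (x t \<omega> - ?z))\<^sup>2)" for t
  have z: "?z \<in> \<Theta>" using xstar[OF T] by (simp add: is_arg_min_def)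
  have progress: "expectation (\<lambda>\<omega>. f t (x t \<omega>)) - f t ?z
      \<le> real P / (2 * \<alpha> t) * (V t - V (Suc t)) + G\<^sup>2 / 2 * \<alpha> t" if "t > 0" for t
    unfolding V_def x_def by (rule rcd_expected_progress) (use assms z that in blast)+
  have R: "V t \<le> R\<^sup>2" if "t > 0" for t
    unfolding V_def
  proof (rule integral_le_const)
    show "integrable M (\<lambda>\<omega>. (norm (x t \<omega> - ?z))\<^sup>2)"
      unfolding x_def by (rule integrable_rcd_iterate) fact
    show "AE \<omega> in M. (norm (x t \<omega> - ?z))\<^sup>2 \<le> R\<^sup>2"
      using iterate_bound[OF that T] by eventually_elim (simp add: power_mono)
  qed
  have V_nonneg: "V t \<ge> 0" for t
    unfolding V_def by (rule Bochner_Integration.integral_nonneg) simp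
  have "static_regret M \<Theta> f x T
      = (\<Sum>t=1..T. expectation (\<lambda>\<omega>. f t (x t \<omega>)) - f t ?z)"
    by (rule static_regret_eq[OF xstar[OF T]])
  also have "\<dots> \<le> (\<Sum>t=1..T. real P / (2 * \<alpha> t) * (V t - V (Suc t)) + G\<^sup>2 / 2 * \<alpha> t)"
    by (intro sum_mono progress) auto
  also have "\<dots> = real P / 2 * (\<Sum>t=1..T. 1 / \<alpha> t * (V t - V (Suc t))) + G\<^sup>2 / 2 * (\<Sum>t=1..T. \<alpha> t)"
    by (simp add: sum.distrib sum_distrib_left)
  also have "\<dots> \<le> real P / 2 * (sqrt (real T) * R\<^sup>2)
      + G\<^sup>2 / 2 * (sqrt 2 / (sqrt 2 - 1) * sqrt (real T))"
  proof (intro add_mono mult_left_mono)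
    have "(\<Sum>t=1..T. 1 / \<alpha> t * (V t - V (Suc t))) \<le> 1 / \<alpha> T * (R\<^sup>2 - V (Suc T))"
      using stepsize assms(11) less_imp_le T
      by (intro weighted_telescope R doubling_trick_decreasing) auto
    also have "\<dots> \<le> 1 / \<alpha> T * R\<^sup>2"
      using V_nonneg[of "Suc T"] assms(11)[of T] by (intro mult_left_mono) auto
    also have "\<dots> \<le> sqrt (real T) * R\<^sup>2"
      using doubling_trick_bounds(1)[OF stepsize[OF T] T] by (intro mult_right_mono) auto
    finally show "(\<Sum>t=1..T. 1 / \<alpha> t * (V t - V (Suc t))) \<le> sqrt (real T) * R\<^sup>2" .
  next
    have "(\<Sum>t=1..T. \<alpha> t) \<le> (\<Sum>t=1..T. sqrt 2 * (1 / sqrt (real t)))"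
      using doubling_trick_bounds(2) stepsize by (intro sum_mono) auto
    also have "\<dots> \<le> sqrt 2 * (2 * sqrt (real T))"
      unfolding sum_distrib_left[symmetric] by (intro mult_left_mono sum_inverse_sqrt_le) auto
    also have "\<dots> \<le> sqrt 2 * (1 / (sqrt 2 - 1) * sqrt (real T))"
    proof (intro mult_left_mono mult_right_mono)
      have "sqrt 2 \<le> 3 / 2" by (rule real_le_lsqrt) (auto simp: power2_eq_square)
      moreover have "sqrt 2 > 1" by simp
      ultimately show "2 \<le> 1 / (sqrt 2 - 1)" by (simp add: field_simps)
    qed auto
    finally show "(\<Sum>t=1..T. \<alpha> t) \<le> sqrt 2 / (sqrt 2 - 1) * sqrt (real T)" by simp
  qed auto
  also have "\<dots> = (real P * R\<^sup>2 / 2 + sqrt 2 * G\<^sup>2 / (2 * (sqrt 2 - 1))) * sqrt (real T)"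
    by (simp add: algebra_simps)
  finally show "static_regret M \<Theta> f x T
      \<le> (real P * R\<^sup>2 / 2 + sqrt 2 * G\<^sup>2 / (2 * (sqrt 2 - 1))) * sqrt (real T)" .
qed

end
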